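(* Let $(X,V,W,S,\mathcal H_*,h,*,\Theta)$ satisfy the abstract symmetrization framework described in the context, and let $\beta$ be a bornology of bounded subsets of $X$. Assume that the Banach space $X$ admits a bump function in $X_\beta$, and let $f:X\to\mathbb R\cup\{+\infty\}$ be a proper, lower semi-continuous functional bounded from below satisfying $f(u^H)\le f(u)$ for all $u\in S$ and $H\in\mathcal H_*$. Then there exists a positive number $\mathcal A$ such that, for all $\varepsilon\in(0,1)$ and $u\in S$ with $f(u)<\inf f+\mathcal A\varepsilon^2$, there exist $g\in X_\beta$ and $v\in X$ such that: (a) $\|v-v^*\|_V<(K(C_\Theta+1)+1)\varepsilon$; (b) $\|v-u\|\le\varepsilon+\|\mathbb T_\varepsilon u-u\|$; (c) $\|g\|_\infty\le\varepsilon$ and $\|g'\|_\infty\le\varepsilon$; (d) $f(w)+g(w)\ge f(v)+g(v)$ for all $w\in X$.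
   Context: Abstract framework. $X,V,W$ are real Banach spaces with $X\subseteq V\subseteq W$, $X$ continuously embedded in $V$ and $V$ continuously embedded in $W$; $\|\cdot\|$ is the norm of $X$ and $K>0$ is a continuity constant of $X\hookrightarrow V$, i.e. $\|u\|_V\le K\|u\|$ for $u\in X$. $S\subseteq X$ carries the metric induced by $\|\cdot\|$, $\mathcal H_*$ is a path-connected topological space, and there are maps $*:S\to S$, $u\mapsto u^*$ (symmetrization) and $h:S\times\mathcal H_*\to S$, $(u,H)\mapsto u^H$ (polarization) such that: $h$ is continuous; $(u^* )^H=(u^H)^*=u^*$ and $(u^H)^H=u^H$ for all $u\in S$, $H\in\mathcal H_*$; there is a sequence $(H_m)\subset\mathcal H_*$ such that for every $u\in S$ the iterated polarizations $u^{H_1\cdots H_m}$ converge to $u^*$ in $V$ as $m\to\infty$; $\|u^H-v^H\|_V\le\|u-v\|_V$ for all $u,v\in S$, $H\in\mathcal H_*$. Moreover $\Theta:(X,\|\cdot\|_V)\to(S,\|\cdot\|_V)$ is Lipschitz with constant $C_\Theta>0$ and $\Theta|_S=\mathrm{Id}|_S$; for $u\in X$ one sets $u^H:=(\Theta(u))^H$ and $u^*:=(\Theta(u))^*$. For every $\rho>0$, $\mathbb T_\rho:S\to S$ denotes a continuous map such that, for every $u\in S$, $\mathbb T_\rho u$ is obtained from $u$ by finitely many iterated polarizations by elements of $\mathcal H_*$, and $\|\mathbb T_\rho u-u^*\|_V<\rho$ (such maps are known to exist in this framework). $\beta$-differentiability. Let $\beta$ be a family of bounded subsets of $X$ which constitutes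 a bornology (in particular it covers $X$; examples: all bounded subsets, giving Fréchet differentiability; all singletons, giving Gateaux differentiability). A functional $f:X\to\mathbb R\cup\{+\infty\}$ is $\beta$-differentiable at $u\in\mathrm{dom}(f)$ with $\beta$-derivative $\varphi=f'(u)\in X'$ (the topological dual) if $\lim_{t\to0}\frac{f(u+tw)-f(u)-\langle\varphi,tw\rangle}{t}=0$ uniformly for $w$ inside the elements of $\beta$. $X_\beta$ is the space of all $g:X\to\mathbb R$ that are bounded, Lipschitzian and $\beta$-differentiable on $X$, with norm $\|g\|_\beta=\|g\|_\infty+\|g'\|_\infty$, where $\|g\|_\infty=\sup_{u\in X}|g(u)|$ and $\|g'\|_\infty=\sup_{u\in X}\|g'(u)\|$. A bump function is an element $b\in X_\beta$ whose support is nonempty and bounded. Proper means not identically $+\infty$. *)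

theory Defs
  imports "HOL-Analysis.Analysis"
begin

text \<open>
  The inclusions of Banach spaces \<open>X \<subseteq> V \<subseteq> W\<close> are rendered by injective bounded linear maps
  \<open>i\<close> and \<open>j\<close> between the types \<open>'x\<close>, \<open>'v\<close>, \<open>'w\<close>, so \<open>norm (i u)\<close> is the \<open>V\<close>-norm of \<open>u \<in> X\<close>.
  The topological space of polarizers is \<open>\<H>\<close>; \<open>pol u H\<close> is the polarization of \<open>u\<close> by \<open>H\<close> and
  \<open>star u\<close> the symmetrization of \<open>u\<close>. Both are meaningful only for \<open>u \<in> S\<close>; for arbitrary
  \<open>u \<in> X\<close> they are \<open>pol (\<Theta> u) H\<close> and \<open>star (\<Theta> u)\<close>. The iterated polarization of \<open>u\<close> by
  \<open>H\<^sub>1, \<dots>, H\<^sub>m\<close>, in this order, is \<open>foldl pol u [H\<^sub>1, \<dots>, H\<^sub>m]\<close>.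
\<close>

locale symmetrization_framework =
  fixes i :: "'x::banach \<Rightarrow> 'v::banach"
    and j :: "'v \<Rightarrow> 'w::banach"
    and K :: real
    and S :: "'x set"
    and \<H> :: "'h topology"
    and pol :: "'x \<Rightarrow> 'h \<Rightarrow> 'x"
    and star :: "'x \<Rightarrow> 'x"
    and \<Theta> :: "'x \<Rightarrow> 'x"
    and C\<^sub>\<Theta> :: real
  assumes embedding_X_V: "bounded_linear i" "inj i"
    and embedding_V_W: "bounded_linear j" "inj j"
    and K_pos: "K > 0"
    and K_bound: "norm (i u) \<le> K * norm u"
    and path_connected_polarizers: "path_connected_space \<H>"
    and star_in: "u \<in> S \<Longrightarrow> star u \<in> S"
    and pol_continuous:
      "continuous_map (prod_topology (top_of_set S) \<H>) (top_of_set S) (\<lambda>(u, H). pol u H)"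
    and pol_star: "u \<in> S \<Longrightarrow> H \<in> topspace \<H> \<Longrightarrow> pol (star u) H = star u"
    and star_pol: "u \<in> S \<Longrightarrow> H \<in> topspace \<H> \<Longrightarrow> star (pol u H) = star u"
    and pol_pol: "u \<in> S \<Longrightarrow> H \<in> topspace \<H> \<Longrightarrow> pol (pol u H) H = pol u H"
    and iterated_polarizations_tendsto:
      "\<exists>Hs :: nat \<Rightarrow> 'h. range Hs \<subseteq> topspace \<H> \<and>
         (\<forall>u\<in>S. (\<lambda>m. i (foldl pol u (map Hs [0..<m]))) \<longlonglongrightarrow> i (star u))"
    and pol_contraction:
      "u \<in> S \<Longrightarrow> v \<in> S \<Longrightarrow> H \<in> topspace \<H> \<Longrightarrow>
         norm (i (pol u H) - i (pol v H)) \<le> norm (i u - i v)"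
    and C\<Theta>_pos: "C\<^sub>\<Theta> > 0"
    and \<Theta>_in: "\<Theta> u \<in> S"
    and \<Theta>_lipschitz: "norm (i (\<Theta> u) - i (\<Theta> v)) \<le> C\<^sub>\<Theta> * norm (i u - i v)"
    and \<Theta>_id: "u \<in> S \<Longrightarrow> \<Theta> u = u"

text \<open>
  No closure under subsets or finite unions is required, so that the family of all singletons
  (which yields Gateaux differentiability) qualifies.
\<close>

definition bornology :: "'x::real_normed_vector set set \<Rightarrow> bool" where
  "bornology \<beta> \<longleftrightarrow> (\<forall>B\<in>\<beta>. bounded B) \<and> \<Union>\<beta> = UNIV"

definition has_beta_derivative ::
  "'x::real_normed_vector set set \<Rightarrow> ('x \<Rightarrow> real) \<Rightarrow> ('x \<Rightarrow>\<^sub>L real) \<Rightarrow> 'x \<Rightarrow> bool" where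
  "has_beta_derivative \<beta> g \<phi> u \<longleftrightarrow>
     (\<forall>B\<in>\<beta>. uniform_limit B
        (\<lambda>t w. (g (u + t *\<^sub>R w) - g u - blinfun_apply \<phi> (t *\<^sub>R w)) / t) (\<lambda>w. 0) (at 0))"

definition beta_deriv ::
  "'x::real_normed_vector set set \<Rightarrow> ('x \<Rightarrow> real) \<Rightarrow> 'x \<Rightarrow> ('x \<Rightarrow>\<^sub>L real)" where
  "beta_deriv \<beta> g u = (THE \<phi>. has_beta_derivative \<beta> g \<phi> u)"

definition beta_space :: "'x::real_normed_vector set set \<Rightarrow> ('x \<Rightarrow> real) set" where
  "beta_space \<beta> = {g. bounded (range g) \<and> (\<exists>L. L-lipschitz_on UNIV g) \<and>
     (\<forall>u. \<exists>\<phi>. has_beta_derivative \<beta> g \<phi> u)}"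

definition sup_norm :: "('a \<Rightarrow> 'b::real_normed_vector) \<Rightarrow> real" where
  "sup_norm F = (SUP u. norm (F u))"

definition bump_function :: "'x::real_normed_vector set set \<Rightarrow> ('x \<Rightarrow> real) \<Rightarrow> bool" where
  "bump_function \<beta> b \<longleftrightarrow> b \<in> beta_space \<beta> \<and>
     closure {u. b u \<noteq> 0} \<noteq> {} \<and> bounded (closure {u. b u \<noteq> 0})"

definition lower_semicontinuous :: "('x::topological_space \<Rightarrow> ereal) \<Rightarrow> bool" where
  "lower_semicontinuous f \<longleftrightarrow> (\<forall>u. f u \<le> Liminf (at u) f)"

text \<open>
  The next lemmas show that, for a bornology, the description in \<^const>\<open>beta_deriv\<close> is proper,
  and that both suprema \<^const>\<open>sup_norm\<close> \<open>g\<close> and \<^const>\<open>sup_norm\<close> \<open>g'\<close> are finite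
  for \<open>g\<close> in \<^const>\<open>beta_space\<close>.
\<close>

lemma has_beta_derivative_directional:
  assumes "bornology \<beta>" "has_beta_derivative \<beta> g \<phi> u"
  shows "((\<lambda>t. (g (u + t *\<^sub>R w) - g u) / t) \<longlongrightarrow> blinfun_apply \<phi> w) (at 0)"
proof -
  obtain B where B: "B \<in> \<beta>" "w \<in> B"
    using assms(1) unfolding bornology_def by blast
  have "((\<lambda>t. (g (u + t *\<^sub>R w) - g u - blinfun_apply \<phi> (t *\<^sub>R w)) / t) \<longlongrightarrow> 0) (at 0)"
    using assms(2) B tendsto_uniform_limitI unfolding has_beta_derivative_def by fastforce
  then have "((\<lambda>t. (g (u + t *\<^sub>R w) - g u - blinfun_apply \<phi> (t *\<^sub>R w)) / t
      + blinfun_apply \<phi> w) \<longlongrightarrow> 0 + blinfun_apply \<phi> w) (at 0)"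
    by (intro tendsto_intros)
  then show ?thesis
    by (rule Lim_transform_eventually[THEN tendsto_eq_rhs])
      (auto simp: eventually_at_filter blinfun.scaleR_right field_simps)
qed

lemma has_beta_derivative_unique:
  assumes "bornology \<beta>" "has_beta_derivative \<beta> g \<phi> u" "has_beta_derivative \<beta> g \<psi> u"
  shows "\<phi> = \<psi>"
  using has_beta_derivative_directional[OF assms(1,2)]
    has_beta_derivative_directional[OF assms(1,3)]
  by (intro blinfun_eqI) (metis LIM_unique)

lemma beta_deriv_eq:
  assumes "bornology \<beta>" "has_beta_derivative \<beta> g \<phi> u"
  shows "beta_deriv \<beta> g u = \<phi>"
  unfolding beta_deriv_def
  using assms has_beta_derivative_unique by (intro the_equality) blast+

lemma bdd_above_beta_space:
  assumes "bornology \<beta>" "g \<in> beta_space \<beta>"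
  shows "bdd_above (range (\<lambda>u. norm (g u)))"
    and "bdd_above (range (\<lambda>u. norm (beta_deriv \<beta> g u)))"
proof -
  show "bdd_above (range (\<lambda>u. norm (g u)))"
    using assms(2) unfolding beta_space_def bounded_iff bdd_above_def by auto
  obtain L where L: "L-lipschitz_on UNIV g"
    using assms(2) unfolding beta_space_def by blast
  have "norm (beta_deriv \<beta> g u) \<le> L" for u
  proof -
    obtain \<phi> where \<phi>: "has_beta_derivative \<beta> g \<phi> u"
      using assms(2) unfolding beta_space_def by blast
    have "norm (blinfun_apply \<phi> w) \<le> L * norm w" for w
    proof (rule tendsto_upperbound)
      show "((\<lambda>t. norm ((g (u + t *\<^sub>R w) - g u) / t)) \<longlongrightarrow> norm (blinfun_apply \<phi> w)) (at 0)"
        by (intro tendsto_norm has_beta_derivative_directional[OF assms(1) \<phi>])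
      have "norm ((g (u + t *\<^sub>R w) - g u) / t) \<le> L * norm w" if "t \<noteq> 0" for t
      proof -
        have "norm (g (u + t *\<^sub>R w) - g u) \<le> L * (\<bar>t\<bar> * norm w)"
          using lipschitz_onD[OF L, of "u + t *\<^sub>R w" u] by (simp add: dist_norm)
        then show ?thesis
          using that by (simp add: field_simps)
      qed
      then show "eventually (\<lambda>t. norm ((g (u + t *\<^sub>R w) - g u) / t) \<le> L * norm w) (at 0)"
        by (simp add: eventually_at_filter)
    qed simp
    then show ?thesis
      using beta_deriv_eq[OF assms(1) \<phi>] lipschitz_on_nonneg[OF L] norm_blinfun_bound by metis
  qed
  then show "bdd_above (range (\<lambda>u. norm (beta_deriv \<beta> g u)))"
    by (auto simp: bdd_above_def)
qed

end

theory Submission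
  imports Defs
begin

text \<open>
  Symmetrize first: the iterated polarization \<open>z = T \<epsilon> u\<close> satisfies \<open>f z \<le> f u\<close> and is
  \<open>\<epsilon>\<close>-close in \<open>V\<close> to \<open>z\<^sup>* = u\<^sup>*\<close>. A smooth variational principle applied at \<open>z\<close> gives a
  minimizer \<open>v\<close> of \<open>f + g\<close> with \<open>\<parallel>v - z\<parallel> \<le> \<epsilon>\<close>, and \<open>v\<close> inherits near-symmetry from \<open>z\<close>
  because symmetrization, a limit of contractions, does not increase \<open>V\<close>-distances.

  The perturbation is \<open>g = - (\<Sum>n. \<mu>\<^sub>n b(\<rho>\<^sub>n (\<cdot> - x\<^sub>n)))\<close> for a bump \<open>b\<close> with \<open>b 0 = 1\<close>: the \<open>n\<close>-th
  term deepens the functional by \<open>\<mu>\<^sub>n\<close> at an approximate minimizer \<open>x\<^sub>n\<close> and leaves it unchanged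
  outside a ball of radius \<open>r\<^sub>n\<close>, so later approximate minimizers stay in that ball. With
  \<open>\<mu>\<^sub>n\<close> of order \<open>\<epsilon>\<^sup>2 / 4\<^sup>n\<close> and \<open>r\<^sub>n\<close> of order \<open>\<epsilon> / 2\<^sup>n\<close> the series and its derivative are
  of order \<open>\<epsilon>\<close>. No Baire category argument is needed, since strong minima are not required.
\<close>

section \<open>Calculus of \<beta>-derivatives: norm bound, sums, affine substitution,
  series\<close>

lemma has_beta_derivative_norm_le:
  assumes "bornology \<beta>" "L-lipschitz_on UNIV g" "has_beta_derivative \<beta> g \<phi> u"
  shows "norm \<phi> \<le> L"
proof -
  have "norm (blinfun_apply \<phi> w) \<le> L * norm w" for w
  proof (rule tendsto_upperbound)
    show "((\<lambda>t. norm ((g (u + t *\<^sub>R w) - g u) / t)) \<longlongrightarrow> norm (blinfun_apply \<phi> w)) (at 0)"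
      by (intro tendsto_norm has_beta_derivative_directional[OF assms(1,3)])
    have "norm ((g (u + t *\<^sub>R w) - g u) / t) \<le> L * norm w" if "t \<noteq> 0" for t
      using lipschitz_onD[OF assms(2), of "u + t *\<^sub>R w" u] that
      by (simp add: dist_norm field_simps)
    then show "eventually (\<lambda>t. norm ((g (u + t *\<^sub>R w) - g u) / t) \<le> L * norm w) (at 0)"
      by (simp add: eventually_at_filter)
  qed simp
  then show ?thesis
    using lipschitz_on_nonneg[OF assms(2)] norm_blinfun_bound by metis
qed

lemma has_beta_derivative_add:
  assumes "has_beta_derivative \<beta> g \<phi> u" "has_beta_derivative \<beta> h \<psi> u"
  shows "has_beta_derivative \<beta> (\<lambda>x. g x + h x) (\<phi> + \<psi>) u"
  unfolding has_beta_derivative_def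
proof
  fix B assume "B \<in> \<beta>"
  with assms have "uniform_limit B
      (\<lambda>t w. (g (u + t *\<^sub>R w) - g u - blinfun_apply \<phi> (t *\<^sub>R w)) / t
        + (h (u + t *\<^sub>R w) - h u - blinfun_apply \<psi> (t *\<^sub>R w)) / t) (\<lambda>w. 0 + 0) (at 0)"
    unfolding has_beta_derivative_def by (intro uniform_limit_add) auto
  then show "uniform_limit B (\<lambda>t w. (g (u + t *\<^sub>R w) + h (u + t *\<^sub>R w) - (g u + h u)
      - blinfun_apply (\<phi> + \<psi>) (t *\<^sub>R w)) / t) (\<lambda>w. 0) (at 0)"
    by (simp add: blinfun.add_left add_divide_distrib[symmetric] algebra_simps)
qed

lemma has_beta_derivative_zero: "has_beta_derivative \<beta> (\<lambda>x. 0) 0 u"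
  unfolding has_beta_derivative_def by (simp add: uniform_limit_const)

lemma has_beta_derivative_sum:
  fixes q :: "nat \<Rightarrow> 'x::real_normed_vector \<Rightarrow> real"
  assumes "\<And>k. k < n \<Longrightarrow> has_beta_derivative \<beta> (q k) (\<phi> k) u"
  shows "has_beta_derivative \<beta> (\<lambda>x. \<Sum>k<n. q k x) (\<Sum>k<n. \<phi> k) u"
  using assms
  by (induction n) (simp_all add: has_beta_derivative_zero has_beta_derivative_add)

text \<open>The substitution of \<open>\<rho> * t\<close> for \<open>t\<close> absorbs the dilation
  into the scalar variable, so the same set \<open>B\<close> serves both sides. Multiplying the
  quotient by \<open>c * \<rho>\<close> then restores the denominator \<open>t\<close>.\<close>

lemma has_beta_derivative_rescale:
  fixes u z :: "'x::real_normed_vector"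
  assumes "has_beta_derivative \<beta> b \<phi> (\<rho> *\<^sub>R u + z)" "\<rho> > 0"
  shows "has_beta_derivative \<beta> (\<lambda>x. c * b (\<rho> *\<^sub>R x + z)) ((c * \<rho>) *\<^sub>R \<phi>) u"
  unfolding has_beta_derivative_def
proof
  fix B assume "B \<in> \<beta>"
  \<comment> \<open>Since \<rho> is nonzero, the dilation preserves punctured neighbourhoods of
    0.\<close>
  have f: "filterlim (\<lambda>t. \<rho> * t) (at 0) (at (0::real))"
    using assms(2) by (auto simp: filterlim_at eventually_at_filter intro!: tendsto_eq_intros)
  have "uniform_limit B (\<lambda>t w. (b (\<rho> *\<^sub>R u + z + t *\<^sub>R w) - b (\<rho> *\<^sub>R u + z)
      - blinfun_apply \<phi> (t *\<^sub>R w)) / t) (\<lambda>w. 0) (at 0)"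
    using assms(1) \<open>B \<in> \<beta>\<close> unfolding has_beta_derivative_def by blast
  then have "uniform_limit B (\<lambda>t w. (b (\<rho> *\<^sub>R u + z + (\<rho> * t) *\<^sub>R w) - b (\<rho> *\<^sub>R u + z)
      - blinfun_apply \<phi> ((\<rho> * t) *\<^sub>R w)) / (\<rho> * t)) (\<lambda>w. 0) (at 0)"
    unfolding uniform_limit_iff using f by (auto simp: filterlim_iff)
  then have "uniform_limit B (\<lambda>t w. (c * \<rho>) *\<^sub>R ((b (\<rho> *\<^sub>R u + z + (\<rho> * t) *\<^sub>R w)
      - b (\<rho> *\<^sub>R u + z) - blinfun_apply \<phi> ((\<rho> * t) *\<^sub>R w)) / (\<rho> * t))) (\<lambda>w. (c * \<rho>) *\<^sub>R 0) (at 0)"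
    by (intro bounded_linear.uniform_limit[OF bounded_linear_scaleR_right])
  moreover have "(c * \<rho>) *\<^sub>R ((b (\<rho> *\<^sub>R u + z + (\<rho> * t) *\<^sub>R w)
      - b (\<rho> *\<^sub>R u + z) - blinfun_apply \<phi> ((\<rho> * t) *\<^sub>R w)) / (\<rho> * t))
      = (c * b (\<rho> *\<^sub>R (u + t *\<^sub>R w) + z) - c * b (\<rho> *\<^sub>R u + z)
        - blinfun_apply ((c * \<rho>) *\<^sub>R \<phi>) (t *\<^sub>R w)) / t" for t w
    using assms(2)
    by (cases "t = 0") (simp_all add: blinfun.scaleR_left blinfun.scaleR_right
        scaleR_add_right field_simps)
  ultimately show "uniform_limit B (\<lambda>t w. (c * b (\<rho> *\<^sub>R (u + t *\<^sub>R w) + z)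
      - c * b (\<rho> *\<^sub>R u + z) - blinfun_apply ((c * \<rho>) *\<^sub>R \<phi>) (t *\<^sub>R w)) / t) (\<lambda>w. 0) (at 0)"
    by simp
qed

lemma lipschitz_on_suminf:
  fixes q :: "nat \<Rightarrow> 'x::metric_space \<Rightarrow> real"
  assumes lip: "\<And>k. (L k)-lipschitz_on UNIV (q k)" and L: "summable L"
    and q: "\<And>x. summable (\<lambda>k. q k x)"
  shows "(\<Sum>k. L k)-lipschitz_on UNIV (\<lambda>x. \<Sum>k. q k x)"
proof (rule lipschitz_onI)
  show "0 \<le> (\<Sum>k. L k)"
    by (intro suminf_nonneg L lipschitz_on_nonneg[OF lip])
  fix x y
  have "norm (\<Sum>k. q k x - q k y) \<le> (\<Sum>k. L k * dist x y)"
    using lipschitz_onD[OF lip] L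
    by (intro norm_suminf_le) (auto simp: dist_norm intro: summable_mult2)
  then show "dist (\<Sum>k. q k x) (\<Sum>k. q k y) \<le> (\<Sum>k. L k) * dist x y"
    by (simp add: dist_norm suminf_diff[OF q q] suminf_mult2[OF L])
qed

text \<open>Termwise differentiation works because the Lipschitz constants dominate the difference
  quotients and the derivatives alike: the tail of the series contributes a quotient that is small
  uniformly in \<open>t\<close> and in \<open>w \<in> B\<close>, and a finite sum remains.\<close>

lemma has_beta_derivative_suminf:
  fixes q :: "nat \<Rightarrow> 'x::real_normed_vector \<Rightarrow> real"
  assumes born: "bornology \<beta>"
    and der: "\<And>k. has_beta_derivative \<beta> (q k) (\<phi> k) u"
    and lip: "\<And>k. (L k)-lipschitz_on UNIV (q k)" and L: "summable L"
    and q: "\<And>x. summable (\<lambda>k. q k x)"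
  shows "has_beta_derivative \<beta> (\<lambda>x. \<Sum>k. q k x) (\<Sum>k. \<phi> k) u"
  unfolding has_beta_derivative_def
proof
  fix B assume B: "B \<in> \<beta>"
  obtain D where D: "D > 0" "\<And>w. w \<in> B \<Longrightarrow> norm w \<le> D"
    using born B unfolding bornology_def by (meson bounded_pos)
  have \<phi>: "norm (\<phi> k) \<le> L k" for k
    using has_beta_derivative_norm_le[OF born lip der] .
  have sum\<phi>: "summable \<phi>"
    using summable_norm_comparison_test[OF _ L] \<phi> summable_norm_cancel by blast
  define Q where "Q g \<psi> t w = (g (u + t *\<^sub>R w) - g u - blinfun_apply \<psi> (t *\<^sub>R w)) / t"
    for g :: "'x \<Rightarrow> real" and \<psi> t w
  \<comment> \<open>The factor 2 counts the increment of \<open>g\<close> and the linear part, each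
    at most \<open>l * D\<close> after division by \<open>t\<close>.\<close>
  have Q_le: "norm (Q g \<psi> t w) \<le> 2 * l * D"
    if "l-lipschitz_on UNIV g" "norm \<psi> \<le> l" "w \<in> B" "t \<noteq> 0" for g \<psi> t w l
  proof -
    have l: "l \<ge> 0" using lipschitz_on_nonneg[OF that(1)] .
    have "\<bar>g (u + t *\<^sub>R w) - g u\<bar> \<le> l * (\<bar>t\<bar> * norm w)"
      using lipschitz_onD[OF that(1), of "u + t *\<^sub>R w" u] by (simp add: dist_norm)
    moreover have "\<bar>blinfun_apply \<psi> (t *\<^sub>R w)\<bar> \<le> l * (\<bar>t\<bar> * norm w)"
      using norm_blinfun[of \<psi> "t *\<^sub>R w"] mult_right_mono[OF that(2), of "norm (t *\<^sub>R w)"] by simp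
    moreover have "l * (\<bar>t\<bar> * norm w) \<le> l * (\<bar>t\<bar> * D)"
      using D(2)[OF that(3)] l by (intro mult_left_mono) auto
    ultimately have "\<bar>g (u + t *\<^sub>R w) - g u - blinfun_apply \<psi> (t *\<^sub>R w)\<bar> \<le> (2 * l * D) * \<bar>t\<bar>"
      by (simp add: algebra_simps)
    then show ?thesis
      using that(4) by (simp add: Q_def field_simps)
  qed
  have split: "Q (\<lambda>x. \<Sum>k. q k x) (\<Sum>k. \<phi> k) t w
      = Q (\<lambda>x. \<Sum>k<N. q k x) (\<Sum>k<N. \<phi> k) t w
        + Q (\<lambda>x. \<Sum>k. q (k + N) x) (\<Sum>k. \<phi> (k + N)) t w" for N t w
  proof -
    have "(\<Sum>k. q k x) = (\<Sum>k<N. q k x) + (\<Sum>k. q (k + N) x)" for x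
      using suminf_split_initial_segment[OF q, of x N] by simp
    moreover have "(\<Sum>k. \<phi> k) = (\<Sum>k<N. \<phi> k) + (\<Sum>k. \<phi> (k + N))"
      using suminf_split_initial_segment[OF sum\<phi>, of N] by simp
    ultimately show ?thesis
      by (simp add: Q_def blinfun.add_left add_divide_distrib[symmetric] algebra_simps)
  qed
  have "uniform_limit B (Q (\<lambda>x. \<Sum>k. q k x) (\<Sum>k. \<phi> k)) (\<lambda>w. 0) (at 0)"
  proof (rule uniform_limitI)
    fix e :: real assume e: "e > 0"
    \<comment> \<open>With this threshold the tail quotient stays below
      \<open>2 * (e / (4 * D)) * D = e / 2\<close>; the finite part takes the other half.\<close>
    obtain N where "norm (\<Sum>k. L (k + N)) < e / (4 * D)"
      using suminf_exist_split[OF _ L, of "e / (4 * D)"] e D(1) by auto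
    then have N: "(\<Sum>k. L (k + N)) < e / (4 * D)" by simp
    have L': "summable (\<lambda>k. L (k + N))"
      using L by (simp add: summable_iff_shift)
    have tail_lip: "(\<Sum>k. L (k + N))-lipschitz_on UNIV (\<lambda>x. \<Sum>k. q (k + N) x)"
      by (intro lipschitz_on_suminf L' lip summable_ignore_initial_segment[OF q])
    have tail_norm: "norm (\<Sum>k. \<phi> (k + N)) \<le> (\<Sum>k. L (k + N))"
      using \<phi> L' by (intro norm_suminf_le) auto
    have "uniform_limit B (Q (\<lambda>x. \<Sum>k<N. q k x) (\<Sum>k<N. \<phi> k)) (\<lambda>w. 0) (at 0)"
      using has_beta_derivative_sum[of N \<beta> q \<phi> u] der B
      unfolding has_beta_derivative_def Q_def by blast
    then have "\<forall>\<^sub>F t in at 0. \<forall>w\<in>B. dist (Q (\<lambda>x. \<Sum>k<N. q k x) (\<Sum>k<N. \<phi> k) t w) 0 < e / 2"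
      using e half_gt_zero unfolding uniform_limit_iff by blast
    moreover have "\<forall>\<^sub>F t in at (0::real). t \<noteq> 0"
      by (simp add: eventually_at_filter)
    ultimately show "\<forall>\<^sub>F t in at 0. \<forall>w\<in>B. dist (Q (\<lambda>x. \<Sum>k. q k x) (\<Sum>k. \<phi> k) t w) 0 < e"
    proof eventually_elim
      case (elim t)
      show ?case
      proof
        fix w assume w: "w \<in> B"
        have "norm (Q (\<lambda>x. \<Sum>k. q (k + N) x) (\<Sum>k. \<phi> (k + N)) t w) \<le> 2 * (\<Sum>k. L (k + N)) * D"
          using Q_le[OF tail_lip tail_norm w] elim by blast
        also have "\<dots> < e / 2"
          using N D(1) by (simp add: field_simps)
        finally show "dist (Q (\<lambda>x. \<Sum>k. q k x) (\<Sum>k. \<phi> k) t w) 0 < e"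
          unfolding split[of t w N] using elim w
          by (smt (verit) dist_0_norm dist_commute field_sum_of_halves norm_triangle_ineq)
      qed
    qed
  qed
  then show "uniform_limit B (\<lambda>t w. ((\<Sum>k. q k (u + t *\<^sub>R w)) - (\<Sum>k. q k u)
      - blinfun_apply (\<Sum>k. \<phi> k) (t *\<^sub>R w)) / t) (\<lambda>w. 0) (at 0)"
    unfolding Q_def .
qed

section \<open>Bounds on supremum norms and a normalized bump\<close>

lemma sup_norm_le: "(\<And>u. norm (F u) \<le> c) \<Longrightarrow> sup_norm F \<le> c"
  unfolding sup_norm_def by (rule cSUP_least) auto

lemma sup_norm_beta_deriv_le:
  assumes "bornology \<beta>" "g \<in> beta_space \<beta>" "L-lipschitz_on UNIV g"
  shows "sup_norm (beta_deriv \<beta> g) \<le> L"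
  using assms has_beta_derivative_norm_le beta_deriv_eq
  unfolding beta_space_def by (intro sup_norm_le) fastforce

text \<open>A point \<open>p\<close> with \<open>b0 p \<noteq> 0\<close> is translated to the origin
  and the function is divided by \<open>b0 p\<close>; boundedness, the Lipschitz property and
  differentiability survive both operations.\<close>

lemma bump_function_normalized:
  fixes \<beta> :: "'x::real_normed_vector set set"
  assumes "bump_function \<beta> b0"
  obtains b :: "'x \<Rightarrow> real" and R M L where
    "b 0 = 1" "R > 0" "\<And>x. norm x \<ge> R \<Longrightarrow> b x = 0" "\<And>x. \<bar>b x\<bar> \<le> M"
    "L-lipschitz_on UNIV b" "\<And>u. \<exists>\<phi>. has_beta_derivative \<beta> b \<phi> u"
proof -
  obtain p where p: "b0 p \<noteq> 0"
    using assms unfolding bump_function_def by force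
  have "bounded {u. b0 u \<noteq> 0}"
    using assms closure_subset bounded_subset unfolding bump_function_def by blast
  then obtain R0 where R0: "\<And>x. b0 x \<noteq> 0 \<Longrightarrow> norm x \<le> R0"
    unfolding bounded_iff by blast
  obtain M where M: "\<And>x. \<bar>b0 x\<bar> \<le> M"
    using assms unfolding bump_function_def beta_space_def bounded_iff by auto
  obtain L where L: "L-lipschitz_on UNIV b0"
    using assms unfolding bump_function_def beta_space_def by blast
  have der: "\<exists>\<phi>. has_beta_derivative \<beta> b0 \<phi> u" for u
    using assms unfolding bump_function_def beta_space_def by blast
  define b where "b x = inverse (b0 p) * b0 (1 *\<^sub>R x + p)" for x
  show ?thesis
  \<comment> \<open>The summand 1 turns the non-strict bound \<open>R0\<close> on the support into
    vanishing on the closed exterior: there \<open>x + p\<close> has norm above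
    \<open>R0\<close>.\<close>
  proof (rule that[of b "R0 + norm p + 1" "\<bar>inverse (b0 p)\<bar> * M" "\<bar>inverse (b0 p)\<bar> * L"])
    show "b 0 = 1" using p by (simp add: b_def)
    show "R0 + norm p + 1 > 0"
      using R0[OF p] norm_ge_zero[of p] by linarith
    show "b x = 0" if "norm x \<ge> R0 + norm p + 1" for x
    proof -
      have "norm x \<le> norm (x + p) + norm p"
        using norm_triangle_ineq4[of "x + p" p] by simp
      then have "b0 (x + p) = 0"
        using R0[of "x + p"] that by fastforce
      then show ?thesis by (simp add: b_def)
    qed
    show "\<bar>b x\<bar> \<le> \<bar>inverse (b0 p)\<bar> * M" for x
      unfolding b_def abs_mult by (intro mult_left_mono M) auto
    show "(\<bar>inverse (b0 p)\<bar> * L)-lipschitz_on UNIV b"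
    proof (rule lipschitz_onI)
      fix x y
      have "\<bar>b0 (x + p) - b0 (y + p)\<bar> \<le> L * dist x y"
        using lipschitz_onD[OF L, of "x + p" "y + p"] by (simp add: dist_norm)
      then have "\<bar>inverse (b0 p)\<bar> * \<bar>b0 (x + p) - b0 (y + p)\<bar> \<le> \<bar>inverse (b0 p)\<bar> * (L * dist x y)"
        by (intro mult_left_mono) auto
      then show "dist (b x) (b y) \<le> \<bar>inverse (b0 p)\<bar> * L * dist x y"
        by (simp add: b_def dist_norm right_diff_distrib[symmetric] abs_mult mult.assoc)
    qed (use lipschitz_on_nonneg[OF L] in simp)
    show "\<exists>\<phi>. has_beta_derivative \<beta> b \<phi> u" for u
      unfolding b_def using der has_beta_derivative_rescale[where \<rho> = 1] by (metis zero_less_one)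
  qed
qed

section \<open>Lower semicontinuity along sequences and approximate minimizers\<close>

lemma lower_semicontinuous_limit_le:
  assumes lsc: "lower_semicontinuous f" and x: "x \<longlonglongrightarrow> v"
    and le: "\<And>n. f (x n) \<le> c n" and c: "c \<longlonglongrightarrow> l"
  shows "f v \<le> l"
proof (rule ccontr)
  assume "\<not> f v \<le> l"
  then obtain y where y: "l < y" "y < f v"
    using dense[of l "f v"] by (auto simp: not_le)
  have "y < Liminf (at v) f"
    using lsc y(2) unfolding lower_semicontinuous_def by (blast intro: order_less_le_trans)
  then have "\<forall>\<^sub>F z in at v. y < f z"
    by (rule less_LiminfD)
  \<comment> \<open>The Liminf ignores the point \<open>v\<close> itself, which the sequence may
    visit; \<open>y < f v\<close> fills the gap.\<close>
  then have "\<forall>\<^sub>F z in nhds v. y < f z"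
    using y(2) by (auto simp: eventually_at_filter elim: eventually_mono)
  then have "\<forall>\<^sub>F n in sequentially. y < f (x n)"
    using x by (auto simp: filterlim_iff)
  moreover have "\<forall>\<^sub>F n in sequentially. c n < y"
    using order_tendstoD(2)[OF c y(1)] .
  ultimately have "\<forall>\<^sub>F n::nat in sequentially. False"
  proof eventually_elim
    case (elim n)
    then show ?case using le[of n] by simp
  qed
  then show False by simp
qed

lemma ex_approximate_minimizer:
  fixes F :: "'a \<Rightarrow> ereal"
  assumes "\<And>x. ereal m \<le> F x" "F a \<noteq> \<infinity>" "\<delta> > 0"
  obtains x where "\<And>y. F x \<le> F y + ereal \<delta>" "F x \<noteq> \<infinity>"
proof -
  define I where "I = (INF x. F x)"
  have "ereal m \<le> I" unfolding I_def by (intro INF_greatest assms)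
  moreover have "I \<le> F a" unfolding I_def by (intro INF_lower) auto
  ultimately have fin: "\<bar>I\<bar> \<noteq> \<infinity>" using assms(2) by auto
  \<comment> \<open>Adding \<delta> is strict only at a finite infimum, hence the lower bound
    \<open>m\<close> and the point \<open>a\<close>.\<close>
  then have "I < I + ereal \<delta>" using assms(3) by (cases I) auto
  then obtain x where x: "F x < I + ereal \<delta>"
    unfolding I_def by (meson INF_less_iff)
  have "F x \<le> F y + ereal \<delta>" for y
  proof -
    have "I \<le> F y" unfolding I_def by (intro INF_lower) auto
    then show ?thesis using x by (meson add_right_mono less_imp_le order_trans)
  qed
  moreover have "F x \<noteq> \<infinity>" using x by auto
  ultimately show ?thesis using that by blast
qed

text \<open>The constant \<open>A\<close> is fixed by the bump before \<open>f\<close>, \<epsilon>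
  and \<open>u\<close> are given, so one threshold serves every base point, in particular an
  iterated polarization in place of the original point.\<close>

proposition smooth_variational_principle:
  fixes \<beta> :: "'x::banach set set"
  assumes born: "bornology \<beta>" and bump: "bump_function \<beta> b0"
  obtains A where "A > 0"
    "\<And>f \<epsilon> u m. lower_semicontinuous f \<Longrightarrow> (\<And>x. ereal m \<le> f x) \<Longrightarrow> 0 < \<epsilon> \<Longrightarrow> \<epsilon> \<le> 1 \<Longrightarrow>
       f u < (INF w. f w) + ereal (A * \<epsilon>\<^sup>2) \<Longrightarrow>
       \<exists>g\<in>beta_space \<beta>. \<exists>v. norm (v - u) \<le> \<epsilon> \<and> sup_norm g \<le> \<epsilon> \<and>
         sup_norm (beta_deriv \<beta> g) \<le> \<epsilon> \<and> (\<forall>w. f v + ereal (g v) \<le> f w + ereal (g w))"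
proof -
  obtain b :: "'x \<Rightarrow> real" and R M L where b0: "b 0 = 1" and R: "R > 0"
    and supp: "\<And>x. norm x \<ge> R \<Longrightarrow> b x = 0" and M: "\<And>x. \<bar>b x\<bar> \<le> M"
    and L: "L-lipschitz_on UNIV b" and der: "\<And>u. \<exists>\<phi>. has_beta_derivative \<beta> b \<phi> u"
    using bump_function_normalized[OF bump] by metis
  have M0: "M \<ge> 0" using M[of 0] by linarith
  have L0: "L \<ge> 0" using lipschitz_on_nonneg[OF L] .
  \<comment> \<open>The denominator makes \<open>c * M\<close> and \<open>c * (R * L)\<close> at
    most 1 simultaneously: one controls the values of the perturbation, the other its slope.\<close>
  define c where "c = 1 / (1 + M + R * L)"
  have RL: "R * L \<ge> 0" using R L0 by simp
  have c: "c > 0" "c * M \<le> 1" "c * (R * L) \<le> 1"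
    using M0 RL unfolding c_def by (simp_all add: field_simps)
  show ?thesis
  \<comment> \<open>This is the value for which \<open>A * \<epsilon>\<^sup>2\<close> equals
    \<open>\<mu> 0 / 2\<close>, the slack permitted at the initial point.\<close>
  proof (rule that[of "c / 8"])
    show "c / 8 > 0" using c by simp
    fix f :: "'x \<Rightarrow> ereal" and \<epsilon> m :: real and u
    assume lsc: "lower_semicontinuous f" and m: "\<And>x. ereal m \<le> f x"
      and \<epsilon>: "0 < \<epsilon>" "\<epsilon> \<le> 1" and u: "f u < (INF w. f w) + ereal (c / 8 * \<epsilon>\<^sup>2)"
    \<comment> \<open>The dilation by \<open>\<rho> n\<close> carries the ball of radius
      \<open>r n\<close> onto that of radius \<open>R\<close>. The ratio
      \<open>\<mu> n / r n\<close> is of order \<open>\<epsilon> / 2 ^ n\<close>, so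
      \<open>r n\<close> can bound the step length, the size and the Lipschitz constant of the n-th
      term at once. Its sum is exactly \<epsilon>.\<close>
    define \<mu> where "\<mu> n = c * \<epsilon>\<^sup>2 * (1/4) ^ Suc n" for n
    define r where "r n = \<epsilon> * (1/2) ^ Suc n" for n
    define \<rho> where "\<rho> n = R / r n" for n
    have r: "r n > 0" and \<rho>: "\<rho> n > 0" and \<mu>: "\<mu> n > 0" for n
      using \<epsilon> R c by (simp_all add: r_def \<rho>_def \<mu>_def)
    have half: "(\<lambda>n. (1/2::real) ^ Suc n) sums 1"
      by (rule power_half_series)
    have r_sums: "r sums \<epsilon>"
      using sums_mult[OF half, of \<epsilon>] by (simp add: r_def[abs_def])
    have quarter: "(1/4::real) ^ n = (1/2) ^ n * (1/2) ^ n" for n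
      by (simp add: power_mult_distrib[symmetric])
    have quarter_le: "(1/4::real) ^ n \<le> (1/2) ^ n" for n
      by (intro power_mono) auto
    \<comment> \<open>Here \<open>\<epsilon> \<le> 1\<close> enters: one of the two factors
      \<epsilon> in \<open>\<mu> n\<close> is given away.\<close>
    have \<mu>M: "\<mu> n * M \<le> r n" for n
    proof -
      have "\<mu> n * M = (c * M) * (\<epsilon> * \<epsilon>) * (1/4) ^ Suc n"
        by (simp add: \<mu>_def power2_eq_square)
      also have "\<dots> \<le> 1 * (\<epsilon> * 1) * (1/2) ^ Suc n"
        using c M0 \<epsilon> by (intro mult_mono quarter_le) auto
      finally show ?thesis by (simp add: r_def)
    qed
    \<comment> \<open>The division by \<open>r n\<close> inside \<open>\<rho> n\<close> cancels one
      \<epsilon> and one of the two powers of 1/2 that make up the power of 1/4.\<close>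
    have \<mu>L: "\<mu> n * \<rho> n * L \<le> r n" for n
    proof -
      have "\<mu> n * \<rho> n * L = (c * (R * L)) * (\<epsilon> * (1/2) ^ Suc n)"
        unfolding \<mu>_def \<rho>_def r_def quarter using \<epsilon>
        by (simp add: field_simps power2_eq_square)
      also have "\<dots> \<le> 1 * (\<epsilon> * (1/2) ^ Suc n)"
        using c \<epsilon> by (intro mult_right_mono) auto
      finally show ?thesis by (simp add: r_def)
    qed
    define \<tau> where "\<tau> k x y = - \<mu> k * b (\<rho> k *\<^sub>R y + - (\<rho> k *\<^sub>R x))" for k x y
    have \<tau>_le: "\<bar>\<tau> k x y\<bar> \<le> r k" for k x y
    proof -
      have "\<bar>\<tau> k x y\<bar> \<le> \<mu> k * M"
        using \<mu>[of k] M by (simp add: \<tau>_def abs_mult)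
      then show ?thesis using \<mu>M[of k] by linarith
    qed
    have \<tau>_lip: "(r k)-lipschitz_on UNIV (\<tau> k x)" for k x
    proof (rule lipschitz_onI)
      fix y z
      have "\<bar>b (\<rho> k *\<^sub>R y + - (\<rho> k *\<^sub>R x)) - b (\<rho> k *\<^sub>R z + - (\<rho> k *\<^sub>R x))\<bar> \<le> L * (\<rho> k * dist y z)"
        using lipschitz_onD[OF L, of "\<rho> k *\<^sub>R y + - (\<rho> k *\<^sub>R x)" "\<rho> k *\<^sub>R z + - (\<rho> k *\<^sub>R x)"] \<rho>[of k]
        by (simp add: dist_norm scaleR_diff_right[symmetric])
      then have "dist (\<tau> k x y) (\<tau> k x z) \<le> \<mu> k * (L * (\<rho> k * dist y z))"
        using \<mu>[of k] by (simp add: \<tau>_def dist_real_def minus_mult_left[symmetric] abs_mult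
            abs_minus_commute right_diff_distrib[symmetric])
      also have "\<dots> \<le> r k * dist y z"
        using mult_right_mono[OF \<mu>L[of k], of "dist y z"] by (simp add: mult_ac)
      finally show "dist (\<tau> k x y) (\<tau> k x z) \<le> r k * dist y z" .
    qed (use r[of k] in simp)
    have \<tau>_der: "\<exists>\<phi>. has_beta_derivative \<beta> (\<tau> k x) \<phi> y" for k x y
      unfolding \<tau>_def using der has_beta_derivative_rescale[OF _ \<rho>[of k]] by metis
    have \<tau>_centre: "\<tau> k x x = - \<mu> k" for k x
      by (simp add: \<tau>_def b0)
    have \<tau>_far: "\<tau> k x y = 0" if "norm (y - x) \<ge> r k" for k x y
    proof -
      have "R = \<rho> k * r k" using r[of k] by (simp add: \<rho>_def)
      also have "\<dots> \<le> \<rho> k * norm (y - x)" using that \<rho>[of k] by simp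
      also have "\<dots> = norm (\<rho> k *\<^sub>R y + - (\<rho> k *\<^sub>R x))"
        using \<rho>[of k] by (simp add: scaleR_diff_right[symmetric])
      finally show ?thesis using supp by (simp add: \<tau>_def)
    qed

    have u_fin: "f u \<noteq> \<infinity>" using u by auto
    have u_min: "f u \<le> f y + ereal (\<mu> 0 / 2)" for y
    proof -
      have "(INF w. f w) + ereal (c / 8 * \<epsilon>\<^sup>2) \<le> f y + ereal (\<mu> 0 / 2)"
        by (intro add_mono INF_lower) (auto simp: \<mu>_def)
      then show ?thesis using u by simp
    qed

    \<comment> \<open>A state consists of the current point and the perturbation accumulated so far.\<close>
    define P where "P n st \<longleftrightarrow> (n = 0 \<longrightarrow> st = (u, \<lambda>_. 0)) \<and> (\<exists>B. \<forall>y. \<bar>snd st y\<bar> \<le> B) \<and>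
        f (fst st) \<noteq> \<infinity> \<and> (\<forall>y. f (fst st) + ereal (snd st (fst st))
          \<le> f y + ereal (snd st y) + ereal (\<mu> n / 2))" for n :: nat and st :: "'x \<times> ('x \<Rightarrow> real)"
    define Q where "Q n st st' \<longleftrightarrow> norm (fst st' - fst st) \<le> r n \<and>
        snd st' = (\<lambda>y. snd st y + \<tau> n (fst st) y)" for n and st st' :: "'x \<times> ('x \<Rightarrow> real)"
    \<comment> \<open>Dependent choice leaves the initial state open, so the clause for
      \<open>n = 0\<close> in \<open>P\<close> pins it to \<open>u\<close> with no perturbation.
      Boundedness and finiteness are carried along to guarantee the next approximate
      minimizer.\<close>
    have "\<exists>s. \<forall>n. P n (s n) \<and> Q n (s n) (s (Suc n))"
    proof (rule dependent_nat_choice)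
      show "\<exists>st. P 0 st"
        by (rule exI[of _ "(u, \<lambda>_. 0)"]) (use u_min u_fin in \<open>auto simp: P_def zero_ereal_def[symmetric]\<close>)
      fix st n
      assume P: "P n st"
      obtain x h where st: "st = (x, h)" by (cases st)
      obtain B where B: "\<And>y. \<bar>h y\<bar> \<le> B" using P st by (auto simp: P_def)
      have x_fin: "f x \<noteq> \<infinity>" using P st by (simp add: P_def)
      have x_min: "f x + ereal (h x) \<le> f y + ereal (h y) + ereal (\<mu> n / 2)" for y
        using P st by (simp add: P_def)
      define h' where "h' y = h y + \<tau> n x y" for y
      have B': "\<bar>h' y\<bar> \<le> B + r n" for y
        using B[of y] \<tau>_le[of n x y] by (simp add: h'_def)
      have "ereal (m - (B + r n)) \<le> f y + ereal (h' y)" for y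
      proof -
        have "ereal (m - (B + r n)) \<le> ereal m + ereal (h' y)"
          using B'[of y] by simp
        also have "\<dots> \<le> f y + ereal (h' y)" by (intro add_right_mono m)
        finally show ?thesis .
      qed
      moreover have "f x + ereal (h' x) \<noteq> \<infinity>" using x_fin by simp
      moreover have "\<mu> (Suc n) / 2 > 0" using \<mu>[of "Suc n"] by simp
      ultimately obtain x' where x':
        "\<And>y. f x' + ereal (h' x') \<le> f y + ereal (h' y) + ereal (\<mu> (Suc n) / 2)"
        "f x' + ereal (h' x') \<noteq> \<infinity>"
        by (rule ex_approximate_minimizer) blast
      have x'_fin: "f x' \<noteq> \<infinity>" using x'(2) by auto
      \<comment> \<open>Outside the ball the new term vanishes, whereas at \<open>x\<close> it gains
        \<open>\<mu> n\<close>. The two approximate minimality inequalities would then give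
        \<open>\<mu> n \<le> \<mu> n / 2 + \<mu> n / 8\<close>, which is impossible.\<close>
      have "norm (x' - x) \<le> r n"
      proof (rule ccontr)
        assume "\<not> norm (x' - x) \<le> r n"
        then have "h' x' = h x'" using \<tau>_far[where k = n and x = x and y = x'] by (simp add: h'_def)
        moreover have "h' x = h x - \<mu> n" by (simp add: h'_def \<tau>_centre)
        moreover obtain a where "f x = ereal a" using x_fin m[of x] by (cases "f x") auto
        moreover obtain a' where "f x' = ereal a'" using x'_fin m[of x'] by (cases "f x'") auto
        moreover have "\<mu> (Suc n) = \<mu> n / 4" by (simp add: \<mu>_def)
        ultimately show False
          using x'(1)[of x] x_min[of x'] \<mu>[of n] by simp
      qed
      then have "P (Suc n) (x', h') \<and> Q n st (x', h')"
        using B' x' x'_fin by (auto simp: P_def Q_def st h'_def[abs_def])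
      then show "\<exists>st'. P (Suc n) st' \<and> Q n st st'" by blast
    qed
    then obtain s where P: "\<And>n. P n (s n)" and Q: "\<And>n. Q n (s n) (s (Suc n))" by blast
    define x where "x n = fst (s n)" for n
    define G where "G n = snd (s n)" for n
    have x0: "x 0 = u" and G0: "G 0 = (\<lambda>_. 0)"
      using P[of 0] by (auto simp: P_def x_def G_def)
    have x_step: "norm (x (Suc n) - x n) \<le> r n" for n
      using Q[of n] by (simp add: Q_def x_def)
    have G_eq: "G n y = (\<Sum>k<n. \<tau> k (x k) y)" for n y
    proof (induction n)
      case (Suc n)
      then show ?case using Q[of n] by (simp add: Q_def x_def G_def)
    qed (simp add: G0)
    have x_min: "f (x n) + ereal (G n (x n)) \<le> f w + ereal (G n w) + ereal (\<mu> n / 2)" for n w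
      using P[of n] by (simp add: P_def x_def G_def)

    have r_summable: "summable r" and r_suminf: "suminf r = \<epsilon>"
      using r_sums by (simp_all add: sums_iff)
    \<comment> \<open>The total displacement converges absolutely, so completeness yields the limit
      \<open>u + d\<close> of the points, and \<open>norm d\<close> is at most the sum of the
      radii.\<close>
    define d where "d = (\<Sum>k. x (Suc k) - x k)"
    have "summable (\<lambda>k. norm (x (Suc k) - x k))"
      by (rule summable_norm_comparison_test[OF _ r_summable]) (simp add: x_step)
    then have "(\<lambda>k. x (Suc k) - x k) sums d"
      unfolding d_def by (rule summable_sums[OF summable_norm_cancel])
    then have "(\<lambda>n. u + (\<Sum>k<n. x (Suc k) - x k)) \<longlonglongrightarrow> u + d"
      unfolding sums_def by (intro tendsto_intros)
    moreover have "u + (\<Sum>k<n. x (Suc k) - x k) = x n" for n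
      by (simp add: sum_lessThan_telescope x0)
    ultimately have x_lim: "x \<longlonglongrightarrow> u + d" by simp
    have d: "norm d \<le> \<epsilon>"
      unfolding d_def r_suminf[symmetric] by (rule norm_suminf_le[OF x_step r_summable])

    define g where "g y = (\<Sum>k. \<tau> k (x k) y)" for y
    have \<tau>_summable: "summable (\<lambda>k. \<tau> k (x k) y)" for y
      using \<tau>_le by (intro summable_norm_cancel[OF summable_norm_comparison_test[OF _ r_summable]]) auto
    have g_le: "\<bar>g y\<bar> \<le> \<epsilon>" for y
      unfolding g_def r_suminf[symmetric] real_norm_def[symmetric]
      by (rule norm_suminf_le[OF _ r_summable]) (simp add: \<tau>_le)
    have g_lip: "\<epsilon>-lipschitz_on UNIV g"
      using lipschitz_on_suminf[OF \<tau>_lip r_summable \<tau>_summable]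
      by (simp add: g_def[abs_def] r_suminf)
    have g_der: "\<exists>\<phi>. has_beta_derivative \<beta> g \<phi> y" for y
    proof -
      have "\<forall>k. \<exists>\<phi>. has_beta_derivative \<beta> (\<tau> k (x k)) \<phi> y"
        using \<tau>_der by blast
      then obtain \<phi> where "\<And>k. has_beta_derivative \<beta> (\<tau> k (x k)) (\<phi> k) y"
        unfolding choice_iff by blast
      then have "has_beta_derivative \<beta> g (\<Sum>k. \<phi> k) y"
        unfolding g_def[abs_def]
        by (rule has_beta_derivative_suminf[OF born _ \<tau>_lip r_summable \<tau>_summable])
      then show ?thesis by blast
    qed
    have g: "g \<in> beta_space \<beta>"
      unfolding beta_space_def using g_le g_lip g_der by (auto simp: bounded_iff)

    have G_lim: "(\<lambda>n. G n y) \<longlonglongrightarrow> g y" for y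
      using summable_LIMSEQ[OF \<tau>_summable] by (simp add: G_eq g_def)
    \<comment> \<open>A Lipschitz constant independent of \<open>n\<close> allows the function and
      its argument to vary together in the limit of \<open>G n (x n)\<close>.\<close>
    have G_lip: "\<bar>G n y - G n z\<bar> \<le> \<epsilon> * dist y z" for n y z
    proof -
      have "\<bar>G n y - G n z\<bar> \<le> (\<Sum>k<n. \<bar>\<tau> k (x k) y - \<tau> k (x k) z\<bar>)"
        unfolding G_eq sum_subtractf[symmetric] by (rule sum_abs)
      also have "\<dots> \<le> (\<Sum>k<n. r k * dist y z)"
        using lipschitz_onD[OF \<tau>_lip] by (intro sum_mono) (simp add: dist_real_def)
      also have "\<dots> = (\<Sum>k<n. r k) * dist y z" by (simp add: sum_distrib_right)
      also have "\<dots> \<le> \<epsilon> * dist y z"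
        unfolding r_suminf[symmetric] using r
        by (intro mult_right_mono sum_le_suminf r_summable) (auto intro: less_imp_le)
      finally show ?thesis .
    qed
    have Gx_lim: "(\<lambda>n. G n (x n)) \<longlonglongrightarrow> g (u + d)"
    proof -
      have "(\<lambda>n. \<epsilon> * dist (x n) (u + d)) \<longlonglongrightarrow> \<epsilon> * 0"
        by (intro tendsto_mult tendsto_const iffD1[OF tendsto_dist_iff x_lim])
      then have "(\<lambda>n. G n (x n) - G n (u + d)) \<longlonglongrightarrow> 0"
        using Lim_null_comparison[where f = "\<lambda>n. G n (x n) - G n (u + d)"
            and g = "\<lambda>n. \<epsilon> * dist (x n) (u + d)" and net = sequentially]
        by (simp add: G_lip)
      from tendsto_add[OF this G_lim[of "u + d"]] show ?thesis by simp
    qed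
    have \<mu>_lim: "\<mu> \<longlonglongrightarrow> 0"
      unfolding \<mu>_def[abs_def]
      by (rule tendsto_mult_right_zero, rule LIMSEQ_Suc, rule LIMSEQ_power_zero) simp
    have "f (u + d) + ereal (g (u + d)) \<le> f w + ereal (g w)" for w
    proof (cases "f w")
      case (real a)
      \<comment> \<open>Solving approximate minimality for \<open>f (x n)\<close> leaves a
        convergent real bound, to which lower semicontinuity applies. The term \<open>0 / 2\<close>
        is the limit of \<open>\<mu> n / 2\<close>.\<close>
      have "f (u + d) \<le> ereal (a + (g w - g (u + d) + 0 / 2))"
      proof (rule lower_semicontinuous_limit_le[OF lsc x_lim])
        show "f (x n) \<le> ereal (a + (G n w - G n (x n) + \<mu> n / 2))" for n
          using x_min[of n w] real by (cases "f (x n)") auto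
        show "(\<lambda>n. ereal (a + (G n w - G n (x n) + \<mu> n / 2)))
            \<longlonglongrightarrow> ereal (a + (g w - g (u + d) + 0 / 2))"
          by (intro tendsto_intros G_lim Gx_lim \<mu>_lim) simp
      qed
      then show ?thesis using real by (cases "f (u + d)") auto
    next
      case MInf
      then show ?thesis using m[of w] by simp
    qed simp
    moreover have "sup_norm g \<le> \<epsilon>" by (rule sup_norm_le) (simp add: g_le)
    moreover have "sup_norm (beta_deriv \<beta> g) \<le> \<epsilon>"
      by (rule sup_norm_beta_deriv_le[OF born g g_lip])
    ultimately show "\<exists>g\<in>beta_space \<beta>. \<exists>v. norm (v - u) \<le> \<epsilon> \<and> sup_norm g \<le> \<epsilon> \<and>
         sup_norm (beta_deriv \<beta> g) \<le> \<epsilon> \<and> (\<forall>w. f v + ereal (g v) \<le> f w + ereal (g w))"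
      using g d by (intro bexI[OF _ g] exI[of _ "u + d"]) simp
  qed
qed

section \<open>Iterated polarizations, symmetrization and almost symmetric points\<close>

context symmetrization_framework
begin

text \<open>Invariance of \<open>S\<close> is contained in the codomain of the continuity
  axiom.\<close>

lemma pol_in: "u \<in> S \<Longrightarrow> H \<in> topspace \<H> \<Longrightarrow> pol u H \<in> S"
  using continuous_map_image_subset_topspace[OF pol_continuous] by fastforce

lemma foldl_pol_in: "u \<in> S \<Longrightarrow> set Hs \<subseteq> topspace \<H> \<Longrightarrow> foldl pol u Hs \<in> S"
  by (induction Hs arbitrary: u) (simp_all add: pol_in)

lemma star_foldl_pol: "u \<in> S \<Longrightarrow> set Hs \<subseteq> topspace \<H> \<Longrightarrow> star (foldl pol u Hs) = star u"
  by (induction Hs arbitrary: u) (simp_all add: pol_in star_pol)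

lemma foldl_pol_contraction:
  "u \<in> S \<Longrightarrow> v \<in> S \<Longrightarrow> set Hs \<subseteq> topspace \<H> \<Longrightarrow>
    norm (i (foldl pol u Hs) - i (foldl pol v Hs)) \<le> norm (i u - i v)"
proof (induction Hs arbitrary: u v)
  case (Cons H Hs)
  then have "norm (i (foldl pol u (H # Hs)) - i (foldl pol v (H # Hs)))
      \<le> norm (i (pol u H) - i (pol v H))"
    by (simp add: pol_in)
  also have "\<dots> \<le> norm (i u - i v)"
    using Cons.prems by (simp add: pol_contraction)
  finally show ?case .
qed simp

text \<open>One sequence of polarizers symmetrizes \<open>u\<close> and \<open>v\<close>
  simultaneously, so the contraction estimate for equal iterates passes to the limit.\<close>

lemma star_contraction:
  assumes "u \<in> S" "v \<in> S"
  shows "norm (i (star u) - i (star v)) \<le> norm (i u - i v)"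
proof -
  obtain Hs :: "nat \<Rightarrow> 'h" where Hs: "range Hs \<subseteq> topspace \<H>"
    "\<And>u. u \<in> S \<Longrightarrow> (\<lambda>m. i (foldl pol u (map Hs [0..<m]))) \<longlonglongrightarrow> i (star u)"
    using iterated_polarizations_tendsto by blast
  have "(\<lambda>m. norm (i (foldl pol u (map Hs [0..<m])) - i (foldl pol v (map Hs [0..<m]))))
      \<longlonglongrightarrow> norm (i (star u) - i (star v))"
    by (intro tendsto_intros Hs assms)
  moreover have "norm (i (foldl pol u (map Hs [0..<m])) - i (foldl pol v (map Hs [0..<m])))
      \<le> norm (i u - i v)" for m
    using assms Hs(1) by (intro foldl_pol_contraction) auto
  ultimately show ?thesis
    by (intro LIMSEQ_le_const2) auto
qed

lemma foldl_pol_functional_le: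
  fixes f :: "'x \<Rightarrow> ereal"
  assumes "\<And>u H. u \<in> S \<Longrightarrow> H \<in> topspace \<H> \<Longrightarrow> f (pol u H) \<le> f u"
  shows "u \<in> S \<Longrightarrow> set Hs \<subseteq> topspace \<H> \<Longrightarrow> f (foldl pol u Hs) \<le> f u"
proof (induction Hs arbitrary: u)
  case (Cons H Hs)
  then have "f (foldl pol u (H # Hs)) \<le> f (pol u H)"
    by (simp add: pol_in)
  also have "\<dots> \<le> f u"
    using Cons.prems by (simp add: assms)
  finally show ?case .
qed simp

text \<open>The path from \<open>v\<close> through \<open>z\<close> and \<open>star z\<close> to
  \<open>star (\<Theta> v)\<close> costs \<open>K * \<epsilon>\<close>, then less than \<epsilon>,
  then \<open>C\<^sub>\<Theta> * K * \<epsilon>\<close>; strictness comes from the middle piece. The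
  last piece uses \<open>\<Theta> z = z\<close>.\<close>

lemma almost_symmetric_near:
  assumes z: "z \<in> S" and z_star: "norm (i z - i (star z)) < \<epsilon>" and v: "norm (v - z) \<le> \<epsilon>"
  shows "norm (i v - i (star (\<Theta> v))) < (K * (C\<^sub>\<Theta> + 1) + 1) * \<epsilon>"
proof -
  have vz: "norm (i v - i z) \<le> K * \<epsilon>"
  proof -
    have "norm (i v - i z) \<le> K * norm (v - z)"
      using K_bound[of "v - z"] bounded_linear.linear[OF embedding_X_V(1)]
      by (simp add: linear_diff)
    also have "\<dots> \<le> K * \<epsilon>" using v K_pos by simp
    finally show ?thesis .
  qed
  have "norm (i (star z) - i (star (\<Theta> v))) \<le> norm (i (\<Theta> z) - i (\<Theta> v))"
    using star_contraction[OF z \<Theta>_in, of v] \<Theta>_id[OF z] by simp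
  also have "\<dots> \<le> C\<^sub>\<Theta> * norm (i v - i z)"
    using \<Theta>_lipschitz[of z v] by (simp add: norm_minus_commute)
  also have "\<dots> \<le> C\<^sub>\<Theta> * (K * \<epsilon>)"
    using vz C\<Theta>_pos by simp
  finally have "norm (i (star z) - i (star (\<Theta> v))) \<le> C\<^sub>\<Theta> * (K * \<epsilon>)" .
  moreover have "norm (i v - i (star (\<Theta> v)))
      \<le> norm (i v - i z) + norm (i z - i (star z)) + norm (i (star z) - i (star (\<Theta> v)))"
    using norm_triangle_ineq[of "i v - i z" "i z - i (star z)"]
      norm_triangle_ineq[of "i v - i (star z)" "i (star z) - i (star (\<Theta> v))"] by simp
  ultimately have "norm (i v - i (star (\<Theta> v))) < K * \<epsilon> + \<epsilon> + C\<^sub>\<Theta> * (K * \<epsilon>)"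
    using vz z_star by linarith
  then show ?thesis by (simp add: algebra_simps)
qed

end

section \<open>Almost symmetric minimizers of smoothly perturbed functionals\<close>

theorem theorem2p18:
  fixes i :: "'x::banach \<Rightarrow> 'v::banach"
    and j :: "'v \<Rightarrow> 'w::banach"
    and K C\<^sub>\<Theta> :: real
    and S :: "'x set"
    and \<H> :: "'h topology"
    and pol :: "'x \<Rightarrow> 'h \<Rightarrow> 'x"
    and star \<Theta> :: "'x \<Rightarrow> 'x"
    and T :: "real \<Rightarrow> 'x \<Rightarrow> 'x"
    and \<beta> :: "'x set set"
    and f :: "'x \<Rightarrow> ereal"
  assumes framework: "symmetrization_framework i j K S \<H> pol star \<Theta> C\<^sub>\<Theta>"
    and T_in: "\<And>\<rho> u. \<rho> > 0 \<Longrightarrow> u \<in> S \<Longrightarrow> T \<rho> u \<in> S"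
    and T_continuous: "\<And>\<rho>. \<rho> > 0 \<Longrightarrow> continuous_on S (T \<rho>)"
    and T_iterated: "\<And>\<rho> u. \<rho> > 0 \<Longrightarrow> u \<in> S \<Longrightarrow>
          \<exists>Hs. set Hs \<subseteq> topspace \<H> \<and> T \<rho> u = foldl pol u Hs"
    and T_approx: "\<And>\<rho> u. \<rho> > 0 \<Longrightarrow> u \<in> S \<Longrightarrow> norm (i (T \<rho> u) - i (star u)) < \<rho>"
    and bornology: "bornology \<beta>"
    and bump: "\<exists>b. bump_function \<beta> b"
    and f_not_MInfty: "\<And>u. f u \<noteq> -\<infinity>"
    and f_proper: "\<exists>u. f u \<noteq> \<infinity>"
    and f_lsc: "lower_semicontinuous f"
    and f_bounded_below: "\<exists>m::real. \<forall>u. ereal m \<le> f u"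
    and f_pol: "\<And>u H. u \<in> S \<Longrightarrow> H \<in> topspace \<H> \<Longrightarrow> f (pol u H) \<le> f u"
  shows "\<exists>A>0. \<forall>\<epsilon>\<in>{0<..<1::real}. \<forall>u\<in>S.
           f u < (INF w. f w) + ereal (A * \<epsilon>\<^sup>2) \<longrightarrow>
           (\<exists>g\<in>beta_space \<beta>. \<exists>v.
              norm (i v - i (star (\<Theta> v))) < (K * (C\<^sub>\<Theta> + 1) + 1) * \<epsilon> \<and>
              norm (v - u) \<le> \<epsilon> + norm (T \<epsilon> u - u) \<and>
              sup_norm g \<le> \<epsilon> \<and> sup_norm (beta_deriv \<beta> g) \<le> \<epsilon> \<and>
              (\<forall>w. f w + ereal (g w) \<ge> f v + ereal (g v)))"
proof -
  interpret symmetrization_framework i j K S \<H> pol star \<Theta> C\<^sub>\<Theta> by (rule framework)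
  obtain b where "bump_function \<beta> b" using bump by blast
  then obtain A where A: "A > 0"
    and principle: "\<And>f \<epsilon> u m. lower_semicontinuous f \<Longrightarrow> (\<And>x. ereal m \<le> f x) \<Longrightarrow> 0 < \<epsilon> \<Longrightarrow> \<epsilon> \<le> 1 \<Longrightarrow>
       f u < (INF w. f w) + ereal (A * \<epsilon>\<^sup>2) \<Longrightarrow>
       \<exists>g\<in>beta_space \<beta>. \<exists>v. norm (v - u) \<le> \<epsilon> \<and> sup_norm g \<le> \<epsilon> \<and>
         sup_norm (beta_deriv \<beta> g) \<le> \<epsilon> \<and> (\<forall>w. f v + ereal (g v) \<le> f w + ereal (g w))"
    using smooth_variational_principle[OF bornology] by metis
  obtain m where m: "\<And>u. ereal m \<le> f u" using f_bounded_below by blast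
  show ?thesis
  proof (intro exI[of _ A] conjI ballI impI A)
    fix \<epsilon> :: real and u
    assume "\<epsilon> \<in> {0<..<1}" and u: "u \<in> S" and fu: "f u < (INF w. f w) + ereal (A * \<epsilon>\<^sup>2)"
    then have \<epsilon>: "0 < \<epsilon>" "\<epsilon> \<le> 1" by auto
    define z where "z = T \<epsilon> u"
    obtain Hs where Hs: "set Hs \<subseteq> topspace \<H>" "z = foldl pol u Hs"
      using T_iterated[OF \<epsilon>(1) u] unfolding z_def by blast
    have z: "z \<in> S" using foldl_pol_in[OF u Hs(1)] Hs(2) by simp
    \<comment> \<open>The approximation property of \<open>T\<close> refers to
      \<open>star u\<close>; equality of the symmetrizations makes it a statement about
      \<open>z\<close> alone.\<close>
    have "star z = star u" using star_foldl_pol[OF u Hs(1)] Hs(2) by simp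
    then have z_star: "norm (i z - i (star z)) < \<epsilon>"
      using T_approx[OF \<epsilon>(1) u] by (simp add: z_def)
    \<comment> \<open>Polarization does not increase \<open>f\<close>, so \<open>z\<close> inherits
      the threshold with the same \<open>A\<close>.\<close>
    have "f z \<le> f u" using foldl_pol_functional_le[of f, OF f_pol u Hs(1)] Hs(2) by simp
    then have "f z < (INF w. f w) + ereal (A * \<epsilon>\<^sup>2)" using fu by simp
    then obtain g v where g: "g \<in> beta_space \<beta>" "sup_norm g \<le> \<epsilon>" "sup_norm (beta_deriv \<beta> g) \<le> \<epsilon>"
      and v: "norm (v - z) \<le> \<epsilon>" and min: "\<And>w. f v + ereal (g v) \<le> f w + ereal (g w)"
      using principle[OF f_lsc m \<epsilon>] by blast
    have "norm (v - u) \<le> \<epsilon> + norm (T \<epsilon> u - u)"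
      using norm_triangle_ineq[of "v - z" "z - u"] v by (simp add: z_def)
    then show "\<exists>g\<in>beta_space \<beta>. \<exists>v.
              norm (i v - i (star (\<Theta> v))) < (K * (C\<^sub>\<Theta> + 1) + 1) * \<epsilon> \<and>
              norm (v - u) \<le> \<epsilon> + norm (T \<epsilon> u - u) \<and>
              sup_norm g \<le> \<epsilon> \<and> sup_norm (beta_deriv \<beta> g) \<le> \<epsilon> \<and>
              (\<forall>w. f w + ereal (g w) \<ge> f v + ereal (g v))"
      using almost_symmetric_near[OF z z_star v] g min by blast
  qed
qed

end
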